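(* Let $n\ge 2$, $\alpha\ge 1$, $M\ge 1$ be integers with $M\le n\alpha$, and let $k=\lceil M/\alpha\rceil$. For any storage scheme over the unidirectional ring network with parameters $(n,\alpha,M)$ and for each user $U_i$, $1\le i\le n$, every reconstruction protocol by which $U_i$ recovers the original data has reconstructing bandwidth at least $$kM-\frac{(k-1)k\alpha}{2}.$$ Moreover, there exists a storage scheme with parameters $(n,\alpha,M)$ (over some finite field) such that every user $U_i$, $1\le i\le n$, can reconstruct the original data with reconstructing bandwidth equal to $kM-\frac{(k-1)k\alpha}{2}$.
   Context: Unidirectional ring network with parameters $(n,\alpha,M)$: there are $n$ storage nodes $N_1,\dots,N_n$ (indices modulo $n$) forming a directed ring; data can be sent only along the edges $N_j\to N_{j-1}$ (in particular $N_1\to N_n$). For each $i$ there is one user $U_i$, connected only to $N_i$ by an edge $N_i\to U_i$. The original data is a row vector $X\in\mathbb{F}_q^M$ of $M$ symbols over a finite field $\mathbb{F}_q$. Storage scheme (linear): a choice of a finite field $\mathbb{F}_q$ and of matrices $G^{(i)}\in\mathbb{F}_q^{M\times\alpha}$, $1\le i\le n$ (node generator matrices), such that the generator matrix $G=[G^{(1)},\dots,G^{(n)}]\in\mathbb{F}_q^{M\times n\alpha}$ has full row rank $M$. Node $N_i$ stores the $\alpha$ coordinates of $XG^{(i)}$; the $\alpha$ columns of $G^{(i)}$ are called the node vectors of $N_i$. Reconstruction protocol for user $U_i$: a finite sequence of transmissions, each sending one symbol of $\mathbb{F}_q$ along an edge $N_j\to N_{j-1}$ of the ring or along $N_i\to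 U_i$. A symbol sent by $N_j$ is a fixed $\mathbb{F}_q$-linear combination of the symbols stored at $N_j$ and the symbols previously received by $N_j$; it thus corresponds to a transmitted vector in $\mathbb{F}_q^M$, the same linear combination of the corresponding vectors. User $U_i$ recovers (reconstructs) the original data if the vectors it receives span $\mathbb{F}_q^M$. The reconstructing bandwidth is the total number of symbols transmitted over all edges, including the edge $N_i\to U_i$. *)

theory Defs
  imports Complex_Main "Jordan_Normal_Form.Missing_VectorSpace"
begin

text \<open>
  Nodes are numbered by the residues \<open>0, ..., n - 1\<close> modulo \<open>n\<close>. Fields are HOL-Algebra records,
  so that the field of a storage scheme can be quantified existentially (every finite field
  is isomorphic to one whose carrier is a set of integers). The space of vectors of
  length \<open>m\<close> over \<open>F\<close> is \<open>func_space\<close> of VectorSpace: functions on \<open>{..<m}\<close> with values in the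
  carrier of \<open>F\<close>, equal to \<open>undefined\<close> outside of \<open>{..<m}\<close>.
\<close>

type_synonym 'f cvec = "nat \<Rightarrow> 'f"
type_synonym 'f cmat = "nat \<Rightarrow> nat \<Rightarrow> 'f"  \<comment> \<open>row index first, then column index\<close>

abbreviation coord_space :: "'f ring \<Rightarrow> nat \<Rightarrow> ('f, 'f cvec) module" where
  "coord_space F m \<equiv> LinearCombinations.ring.func_space F {..<m}"

abbreviation vec_span :: "'f ring \<Rightarrow> nat \<Rightarrow> 'f cvec set \<Rightarrow> 'f cvec set" where
  "vec_span F m S \<equiv> LinearCombinations.module.span F (coord_space F m) S"

definition mat_column :: "nat \<Rightarrow> 'f cmat \<Rightarrow> nat \<Rightarrow> 'f cvec" where
  "mat_column m A c = (\<lambda>r\<in>{..<m}. A r c)"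

definition mat_columns :: "nat \<Rightarrow> nat \<Rightarrow> 'f cmat \<Rightarrow> 'f cvec set" where
  "mat_columns m l A = mat_column m A ` {..<l}"

definition mat_rank :: "'f ring \<Rightarrow> nat \<Rightarrow> nat \<Rightarrow> 'f cmat \<Rightarrow> nat" where
  "mat_rank F m l A =
     vectorspace.dim F ((coord_space F m)\<lparr>carrier := vec_span F m (mat_columns m l A)\<rparr>)"

text \<open>The horizontal concatenation of the blocks \<open>G 0\<close>, \<open>G 1\<close>, ... of width \<open>\<alpha>\<close>.\<close>

definition generator_matrix :: "nat \<Rightarrow> (nat \<Rightarrow> 'f cmat) \<Rightarrow> 'f cmat" where
  "generator_matrix \<alpha> G = (\<lambda>r c. G (c div \<alpha>) r (c mod \<alpha>))"

definition storage_scheme ::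
    "'f ring \<Rightarrow> nat \<Rightarrow> nat \<Rightarrow> nat \<Rightarrow> (nat \<Rightarrow> 'f cmat) \<Rightarrow> bool" where
  "storage_scheme F n \<alpha> M G \<longleftrightarrow>
     field F \<and> finite (carrier F) \<and>
     (\<forall>j<n. \<forall>r<M. \<forall>c<\<alpha>. G j r c \<in> carrier F) \<and>
     mat_rank F M (n * \<alpha>) (generator_matrix \<alpha> G) = M"

definition prev_node :: "nat \<Rightarrow> nat \<Rightarrow> nat" where
  "prev_node n j = (j + n - 1) mod n"

text \<open>
  \<open>Ring j\<close> is the edge from node \<open>j\<close> to node \<open>prev_node n j\<close>, and \<open>Access i\<close> is the edge from
  node \<open>i\<close> to its user. A transmission of the symbol \<open>X v\<close>, where \<open>X\<close> is the row vector of
  original data, is represented by its edge and the transmitted vector \<open>v\<close>.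
\<close>

datatype edge = Ring nat | Access nat

fun sender :: "edge \<Rightarrow> nat" where
  "sender (Ring j) = j"
| "sender (Access i) = i"

type_synonym 'f transmission = "edge \<times> 'f cvec"

definition received_by_node :: "nat \<Rightarrow> 'f transmission list \<Rightarrow> nat \<Rightarrow> 'f cvec set" where
  "received_by_node n ts j = {v. \<exists>s<n. prev_node n s = j \<and> (Ring s, v) \<in> set ts}"

definition received_by_user :: "'f transmission list \<Rightarrow> nat \<Rightarrow> 'f cvec set" where
  "received_by_user ts i = {v. (Access i, v) \<in> set ts}"

text \<open>
  The transmission number \<open>t\<close> may use what its sender received in the transmissions before \<open>t\<close>.
\<close>

definition reconstruction_protocol ::
    "'f ring \<Rightarrow> nat \<Rightarrow> nat \<Rightarrow> nat \<Rightarrow> (nat \<Rightarrow> 'f cmat) \<Rightarrow> nat \<Rightarrow> 'f transmission list \<Rightarrow> bool" where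
  "reconstruction_protocol F n \<alpha> M G i ts \<longleftrightarrow>
     (\<forall>t<length ts. case ts ! t of (e, v) \<Rightarrow>
        e \<in> insert (Access i) (Ring ` {..<n}) \<and>
        v \<in> vec_span F M
              (mat_columns M \<alpha> (G (sender e)) \<union> received_by_node n (take t ts) (sender e)))"

definition user_recovers :: "'f ring \<Rightarrow> nat \<Rightarrow> nat \<Rightarrow> 'f transmission list \<Rightarrow> bool" where
  "user_recovers F M i ts \<longleftrightarrow> vec_span F M (received_by_user ts i) = carrier (coord_space F M)"

definition bandwidth :: "'f transmission list \<Rightarrow> nat" where
  "bandwidth ts = length ts"

end

theory Submission
  imports
    Defs
    "HOL-Number_Theory.Residues"
    "HOL-Computational_Algebra.Polynomial"
begin

text \<open>
  Cut the ring behind the nodes \<open>i, ..., i + m - 1\<close>. Everything these nodes send is spanned by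
  their own \<open>m \<alpha>\<close> node vectors and by what crosses the only ring edge entering the cut, so that
  edge carries at least \<open>M - m \<alpha>\<close> symbols; likewise the access edge, with \<open>m = 0\<close>. For \<open>m < k\<close>
  these edges are distinct, and the sum of the bounds is the claimed bandwidth.

  The bound is attained when the data can be recovered from any \<open>M\<close> of the \<open>n \<alpha>\<close> node vectors,
  as with Vandermonde columns over a prime field with more than \<open>n \<alpha>\<close> elements: each node passes
  on what it receives and adds its own symbols, the farthest of the \<open>k\<close> nodes only those needed
  to make up \<open>M\<close>.
\<close>

section \<open>The coordinate space\<close>

lemma (in cring) func_space_simps:
  "carrier (func_space S) = S \<rightarrow>\<^sub>E carrier R"
  "\<zero>\<^bsub>func_space S\<^esub> = (\<lambda>v\<in>S. \<zero>)"
  "f \<oplus>\<^bsub>func_space S\<^esub> g = (\<lambda>v\<in>S. f v \<oplus> g v)"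
  "c \<odot>\<^bsub>func_space S\<^esub> f = (\<lambda>v\<in>S. c \<otimes> f v)"
  by (simp_all add: func_space_def)

lemma (in field) vectorspace_func_space: "vectorspace R (func_space S)"
  using func_space_is_module field_axioms
  by (auto simp: vectorspace_def module_def)

text \<open>Evaluation at a coordinate is linear; this turns identities between vectors into finite
  sums in the field.\<close>

lemma (in cring) lincomb_func_space_apply:
  assumes "finite A" and "A \<subseteq> carrier (func_space S)" and "a \<in> A \<rightarrow> carrier R" and "r \<in> S"
  shows "module.lincomb (func_space S) a A r = (\<Oplus>v\<in>A. a v \<otimes> v r)"
proof -
  interpret V: module R "func_space S"
    by (rule func_space_is_module)
  show ?thesis
    using assms
  proof (induction A rule: finite_induct)
    case empty
    then show ?case
      by (simp add: V.lincomb_def func_space_simps)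
  next
    case (insert w A)
    have w: "w \<in> S \<rightarrow>\<^sub>E carrier R" and A: "A \<subseteq> S \<rightarrow>\<^sub>E carrier R"
      using insert.prems by (auto simp: func_space_simps)
    have "V.lincomb a (insert w A) = a w \<odot>\<^bsub>func_space S\<^esub> w \<oplus>\<^bsub>func_space S\<^esub> V.lincomb a A"
      using V.lincomb_insert[of A a w] insert by (auto simp: Pi_def)
    then have "V.lincomb a (insert w A) r = a w \<otimes> w r \<oplus> (\<Oplus>v\<in>A. a v \<otimes> v r)"
      using insert by (simp add: func_space_simps)
    also have "\<dots> = (\<Oplus>v\<in>insert w A. a v \<otimes> v r)"
      using insert.prems insert.hyps w A
      by (subst finsum_insert) (auto simp: Pi_def PiE_def subset_iff)
    finally show ?case .
  qed
qed

lemma (in field) basis_unit_vectors: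
  fixes m :: nat
  defines "E \<equiv> (\<lambda>j. \<lambda>r\<in>{..<m}. if r = j then \<one> else \<zero>) ` {..<m}"
  shows "vectorspace.basis R (func_space {..<m}) E" and "card E = m"
proof -
  let ?V = "func_space {..<m} :: ('a, nat \<Rightarrow> 'a) module"
  interpret V: vectorspace R ?V
    by (rule vectorspace_func_space)
  define e where "e = (\<lambda>j. \<lambda>r\<in>{..<m}. if r = j then \<one> else \<zero>)"
  have E: "E = e ` {..<m}"
    by (simp add: E_def e_def)
  have inj: "inj_on e {..<m}"
  proof (rule inj_onI)
    fix x y assume xy: "x \<in> {..<m}" "y \<in> {..<m}" and "e x = e y"
    then have "e x x = e y x"
      by simp
    then show "x = y"
      using xy by (simp add: e_def split: if_splits)
  qed
  then show "card E = m"
    by (simp add: E card_image)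
  have fin: "finite E" and sub: "E \<subseteq> carrier ?V"
    by (auto simp: E e_def func_space_simps split: if_splits)
  \<comment> \<open>The coordinates of a combination of unit vectors are its coefficients.
    Independence and spanning both follow from this.\<close>
  have coord: "V.lincomb a E r = a (e r)" if a: "a \<in> E \<rightarrow> carrier R" and r: "r < m" for a r
  proof -
    have ae: "a (e j) \<in> carrier R" if "j < m" for j
      using a that by (auto simp: E)
    have er: "e j r = (if r = j then \<one> else \<zero>)" for j
      using r by (simp add: e_def)
    have "V.lincomb a E r = (\<Oplus>v\<in>E. a v \<otimes> v r)"
      using lincomb_func_space_apply[OF fin sub a] r by simp
    also have "\<dots> = (\<Oplus>j\<in>{..<m}. a (e j) \<otimes> e j r)"
      unfolding E by (rule finsum_reindex[OF _ inj]) (auto simp: ae er)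
    also have "\<dots> = (\<Oplus>j\<in>{..<m}. if r = j then a (e j) else \<zero>)"
      by (intro finsum_cong') (auto simp: ae er)
    also have "\<dots> = a (e r)"
      using r by (intro finsum_singleton) (auto simp: ae)
    finally show ?thesis .
  qed
  have "V.lin_indpt E"
  proof (rule V.finite_lin_indpt2[OF fin sub], intro ballI)
    fix a v assume a: "a \<in> E \<rightarrow> carrier R" and 0: "V.lincomb a E = \<zero>\<^bsub>?V\<^esub>" and "v \<in> E"
    then obtain r where "r < m" "v = e r"
      by (auto simp: E)
    with coord[OF a] 0 show "a v = \<zero>"
      by (simp add: func_space_simps)
  qed
  moreover have "carrier ?V \<subseteq> V.span E"
  proof
    fix v assume v: "v \<in> carrier ?V"
    \<comment> \<open>Coefficients are indexed by vectors, not by positions, so the position is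
      recovered by inverting \<open>e\<close>.\<close>
    define a where "a w = v (inv_into {..<m} e w)" for w
    have ae: "a (e r) = v r" if "r < m" for r
      using that inj by (simp add: a_def)
    have a: "a \<in> E \<rightarrow> carrier R"
      using v ae by (auto simp: E func_space_simps)
    have "V.lincomb a E \<in> carrier ?V"
      using a sub by blast
    then have "V.lincomb a E = v"
      using v coord[OF a] ae by (intro PiE_ext[of _ "{..<m}"]) (auto simp: func_space_simps)
    then show "v \<in> V.span E"
      using a fin sub by (auto simp: V.finite_span)
  qed
  ultimately show "V.basis E"
    using sub V.span_is_subset2[OF sub] by (auto simp: V.basis_def)
qed

lemma (in field) dim_func_space:
  fixes m :: nat
  shows "vectorspace.dim R (func_space {..<m}) = m" and "vectorspace.fin_dim R (func_space {..<m})"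
proof -
  interpret V: vectorspace R "func_space {..<m}"
    by (rule vectorspace_func_space)
  show "V.dim = m" "V.fin_dim"
    using V.dim_basis[OF _ basis_unit_vectors(1)] basis_unit_vectors[of m]
    by (auto simp: V.fin_dim_def V.basis_def)
qed

lemma (in field) span_memI:
  assumes "v \<in> S" and "v \<in> carrier (func_space {..<m::nat})"
  shows "v \<in> module.span R (func_space {..<m}) S"
proof -
  interpret V: vectorspace R "func_space {..<m}"
    by (rule vectorspace_func_space)
  show ?thesis
    using V.in_own_span[of "{v}"] V.span_is_monotone[of "{v}" S] assms by auto
qed

section \<open>The lower bound\<close>

text \<open>Each node has exactly one in-neighbour on the ring; this is what limits a segment of
  consecutive nodes to a single entering edge.\<close>

lemma prev_node_eqD:
  assumes "s < n" and "prev_node n s = (i + l) mod n"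
  shows "s = (i + Suc l) mod n"
proof -
  have "(i + Suc l) mod n = ((s + n - 1) mod n + 1) mod n"
    using assms(2) by (simp add: prev_node_def mod_Suc_eq)
  also have "\<dots> = (s + n) mod n"
    using assms(1) by (simp only: mod_add_left_eq) simp
  finally show ?thesis
    using assms(1) by simp
qed

lemma inj_on_add_mod:
  fixes n i :: nat
  shows "inj_on (\<lambda>l. (i + l) mod n) {..<n}"
proof (rule inj_onI)
  fix x y assume "x \<in> {..<n}" "y \<in> {..<n}" "(i + x) mod n = (i + y) mod n"
  then have "[x = y] (mod n)"
    using cong_add_lcancel_nat[of i x y n] by (simp add: cong_def)
  then show "x = y"
    using \<open>x \<in> {..<n}\<close> \<open>y \<in> {..<n}\<close> by (simp add: cong_def)
qed

definition vectors_on :: "'f transmission list \<Rightarrow> edge \<Rightarrow> 'f cvec set" where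
  "vectors_on ts e = {v. (e, v) \<in> set ts}"

text \<open>A vector repeated on an edge costs bandwidth each time but counts once in the set, hence
  only an inequality.\<close>

lemma finite_vectors_on: "finite (vectors_on ts e)"
  and card_vectors_on_le: "card (vectors_on ts e) \<le> count_list (map fst ts) e"
proof -
  have "vectors_on ts e = set (map snd (filter (\<lambda>x. fst x = e) ts))"
    by (force simp: vectors_on_def)
  moreover have "length (filter (\<lambda>x. fst x = e) ts) = count_list (map fst ts) e"
    by (induction ts) auto
  ultimately show "finite (vectors_on ts e)" "card (vectors_on ts e) \<le> count_list (map fst ts) e"
    by (metis List.finite_set, metis card_length length_map)
qed

lemma mat_columns_carrier:
  assumes "\<And>r c. r < m \<Longrightarrow> c < l \<Longrightarrow> A r c \<in> carrier F" and "field F"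
  shows "mat_columns m l A \<subseteq> carrier (coord_space F m)"
proof -
  interpret field F by fact
  show ?thesis
    using assms(1) unfolding mat_columns_def mat_column_def func_space_simps
    by (auto intro!: restrict_PiE[THEN iffD2])
qed

lemma reconstruction_protocolD:
  assumes "reconstruction_protocol F n \<alpha> M G i ts" and "t < length ts"
  shows "fst (ts ! t) \<in> insert (Access i) (Ring ` {..<n})"
    and "snd (ts ! t) \<in> vec_span F M (mat_columns M \<alpha> (G (sender (fst (ts ! t)))) \<union>
           received_by_node n (take t ts) (sender (fst (ts ! t))))"
  using assms(1)[unfolded reconstruction_protocol_def case_prod_unfold, rule_format, OF assms(2)]
  by simp_all

text \<open>Induction on time: whatever a sender in \<open>A\<close> has received came either from
  inside \<open>A\<close>, where the induction hypothesis applies to the earlier transmission, or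
  over the entering edge \<open>Ring b\<close>.\<close>

lemma transmitted_in_cut_span:
  assumes F: "field F" and A: "A \<subseteq> {..<n}"
    and entry: "\<And>s. s < n \<Longrightarrow> prev_node n s \<in> A \<Longrightarrow> s \<in> A \<or> s = b"
    and prot: "reconstruction_protocol F n \<alpha> M G i ts"
    and sub: "(\<Union>j\<in>A. mat_columns M \<alpha> (G j)) \<subseteq> carrier (coord_space F M)"
      "vectors_on ts (Ring b) \<subseteq> carrier (coord_space F M)"
    and "t < length ts" and "sender (fst (ts ! t)) \<in> A"
  shows "snd (ts ! t) \<in>
    vec_span F M ((\<Union>j\<in>A. mat_columns M \<alpha> (G j)) \<union> vectors_on ts (Ring b))"
  using assms(7,8)
proof (induction t rule: less_induct)
  case (less t)
  interpret field F by fact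
  interpret V: vectorspace F "coord_space F M"
    by (rule vectorspace_func_space)
  let ?C = "(\<Union>j\<in>A. mat_columns M \<alpha> (G j)) \<union> vectors_on ts (Ring b)"
  let ?j = "sender (fst (ts ! t))"
  have C: "?C \<subseteq> carrier (coord_space F M)"
    using sub by blast
  have "received_by_node n (take t ts) ?j \<subseteq> V.span ?C"
  proof
    fix v assume "v \<in> received_by_node n (take t ts) ?j"
    then obtain s where s: "s < n" "prev_node n s = ?j" "(Ring s, v) \<in> set (take t ts)"
      by (auto simp: received_by_node_def)
    then obtain u where u: "u < t" "ts ! u = (Ring s, v)"
      using less.prems(1) by (auto simp: in_set_conv_nth)
    show "v \<in> V.span ?C"
    proof (cases "s \<in> A")
      case True
      then show ?thesis
        using less.IH[of u] u less.prems(1) by simp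
    next
      case False
      then have "s = b"
        using entry[OF s(1)] s(2) less.prems(2) by auto
      then have "v \<in> vectors_on ts (Ring b)"
        using u less.prems(1) nth_mem[of u ts] by (simp add: vectors_on_def)
      then show ?thesis
        using V.in_own_span[OF C] by blast
    qed
  qed
  moreover have "mat_columns M \<alpha> (G ?j) \<subseteq> V.span ?C"
    using V.in_own_span[OF C] less.prems(2) by blast
  ultimately have "V.span (mat_columns M \<alpha> (G ?j) \<union> received_by_node n (take t ts) ?j) \<subseteq> V.span ?C"
    by (intro V.span_is_subset V.span_is_submodule C) auto
  then show ?case
    using reconstruction_protocolD(2)[OF prot less.prems(1)] by blast
qed

text \<open>The protocol only asks for membership in spans, and a span is known to stay in the space
  only if its generators do. Induction on time supplies this for the received vectors.\<close>

lemma protocol_carrier: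
  assumes F: "field F" and "i < n"
    and cols: "\<And>j. j < n \<Longrightarrow> mat_columns M \<alpha> (G j) \<subseteq> carrier (coord_space F M)"
    and prot: "reconstruction_protocol F n \<alpha> M G i ts"
    and "t < length ts"
  shows "snd (ts ! t) \<in> carrier (coord_space F M)"
  using assms(5)
proof (induction t rule: less_induct)
  case (less t)
  interpret field F by fact
  interpret V: vectorspace F "coord_space F M"
    by (rule vectorspace_func_space)
  have "sender (fst (ts ! t)) < n"
    using reconstruction_protocolD(1)[OF prot less.prems] \<open>i < n\<close> by auto
  moreover have "received_by_node n (take t ts) (sender (fst (ts ! t))) \<subseteq> carrier (coord_space F M)"
  proof
    fix v assume "v \<in> received_by_node n (take t ts) (sender (fst (ts ! t)))"
    then obtain u s where "u < t" "ts ! u = (Ring s, v)"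
      using less.prems by (auto simp: received_by_node_def in_set_conv_nth)
    then show "v \<in> carrier (coord_space F M)"
      using less.IH[of u] less.prems by simp
  qed
  ultimately show ?case
    using reconstruction_protocolD(2)[OF prot less.prems] cols
    by (meson V.span_is_subset2 Un_least subsetD)
qed

lemma gen_set_card_ge:
  assumes "field F" and "finite S" and "S \<subseteq> carrier (coord_space F m)"
    and "vec_span F m S = carrier (coord_space F m)"
  shows "m \<le> card S"
proof -
  interpret field F by fact
  interpret V: vectorspace F "coord_space F m"
    by (rule vectorspace_func_space)
  show ?thesis
    using V.gen_ge_dim[OF assms(2-4)] dim_func_space(1) by simp
qed

lemma card_mat_columns_le: "card (mat_columns m l A) \<le> l" and finite_mat_columns: "finite (mat_columns m l A)"
  using card_image_le[of "{..<l}" "mat_column m A"] by (simp_all add: mat_columns_def)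

text \<open>The edges on the way to the user, counted backwards: for \<open>m > 0\<close>, edge
  \<open>m\<close> starts \<open>m\<close> steps upstream of node \<open>i\<close> and enters the
  segment of the \<open>m\<close> nodes \<open>i, ..., i + m - 1\<close>.\<close>

definition path_edge :: "nat \<Rightarrow> nat \<Rightarrow> nat \<Rightarrow> edge" where
  "path_edge n i m = (if m = 0 then Access i else Ring ((i + m) mod n))"

lemma inj_on_path_edge: "inj_on (path_edge n i) {..<n}"
  using inj_on_add_mod[of i n]
  by (auto simp: path_edge_def intro!: inj_onI dest: inj_onD split: if_splits)

text \<open>The cut bound: the node vectors of the \<open>m\<close> nodes nearest to the user,
  together with the vectors on the edge entering their segment, generate the whole space, so there
  are at least \<open>M\<close> of them.\<close>

lemma path_edge_load:
  assumes "storage_scheme F n \<alpha> M G" and "i < n" and "m < n"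
    and prot: "reconstruction_protocol F n \<alpha> M G i ts" and rec: "user_recovers F M i ts"
  shows "M \<le> m * \<alpha> + count_list (map fst ts) (path_edge n i m)"
proof -
  have F: "field F" and entries: "\<And>j r c. j < n \<Longrightarrow> r < M \<Longrightarrow> c < \<alpha> \<Longrightarrow> G j r c \<in> carrier F"
    using assms(1) by (auto simp: storage_scheme_def)
  interpret field F by fact
  interpret V: vectorspace F "coord_space F M"
    by (rule vectorspace_func_space)
  have cols: "mat_columns M \<alpha> (G j) \<subseteq> carrier (coord_space F M)" if "j < n" for j
    using mat_columns_carrier[OF _ F] entries[OF that] by blast
  have on: "vectors_on ts e \<subseteq> carrier (coord_space F M)" for e
    using protocol_carrier[OF F \<open>i < n\<close> cols prot]
    by (fastforce simp: vectors_on_def in_set_conv_nth)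
  define A where "A = (\<lambda>l. (i + l) mod n) ` {..<m}"
  define C where "C = (\<Union>j\<in>A. mat_columns M \<alpha> (G j)) \<union> vectors_on ts (path_edge n i m)"
  have A: "A \<subseteq> {..<n}" "card A \<le> m" "finite A"
    using \<open>i < n\<close> card_image_le[of "{..<m}" "\<lambda>l. (i + l) mod n"] by (auto simp: A_def)
  have C: "C \<subseteq> carrier (coord_space F M)"
    using cols on A(1) by (auto simp: C_def)
  have "vectors_on ts (Access i) \<subseteq> V.span C"
  \<comment> \<open>For \<open>m = 0\<close> the segment is empty and \<open>C\<close> consists of
    the user's own vectors, so no cut argument applies.\<close>
  proof (cases "m = 0")
    case True
    then show ?thesis
      using V.in_own_span[OF C] by (auto simp: C_def path_edge_def)
  next
    case False
    then have "i \<in> A"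
      using \<open>i < n\<close> by (auto simp: A_def intro!: image_eqI[of _ _ 0])
    \<comment> \<open>The in-neighbour of the node at offset \<open>l\<close> has offset
      \<open>l + 1\<close>, which leaves the segment only when \<open>l + 1 = m\<close>.\<close>
    have entry: "s \<in> A \<or> s = (i + m) mod n" if "s < n" "prev_node n s \<in> A" for s
    proof -
      from that obtain l where l: "l < m" "s = (i + Suc l) mod n"
        using prev_node_eqD by (auto simp: A_def)
      then show ?thesis
        by (cases "Suc l = m") (auto simp: A_def intro!: image_eqI[of _ _ "Suc l"])
    qed
    have cut: "snd (ts ! t) \<in> V.span C" if "t < length ts" "sender (fst (ts ! t)) \<in> A" for t
      using transmitted_in_cut_span[OF F A(1) entry prot _ on that] C False
      by (auto simp: C_def path_edge_def)
    show ?thesis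
    proof
      fix v assume "v \<in> vectors_on ts (Access i)"
      then obtain t where "t < length ts" "ts ! t = (Access i, v)"
        by (auto simp: vectors_on_def in_set_conv_nth)
      then show "v \<in> V.span C"
        using cut[of t] \<open>i \<in> A\<close> by simp
    qed
  qed
  then have "V.span (vectors_on ts (Access i)) \<subseteq> V.span C"
    by (intro V.span_is_subset V.span_is_submodule C)
  then have gen: "V.span C = carrier (coord_space F M)"
    using rec V.span_is_subset2[OF C]
    by (auto simp: user_recovers_def received_by_user_def vectors_on_def)
  have "card (\<Union>j\<in>A. mat_columns M \<alpha> (G j)) \<le> (\<Sum>j\<in>A. card (mat_columns M \<alpha> (G j)))"
    by (rule card_UN_le[OF A(3)])
  also have "\<dots> \<le> card A * \<alpha>"
    using sum_bounded_above[of A "\<lambda>j. card (mat_columns M \<alpha> (G j))" \<alpha>] card_mat_columns_le by auto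
  also have "\<dots> \<le> m * \<alpha>"
    using A(2) by simp
  finally have "card C \<le> m * \<alpha> + count_list (map fst ts) (path_edge n i m)"
    unfolding C_def using card_Un_le card_vectors_on_le[of ts "path_edge n i m"]
    by (meson add_mono order_trans)
  moreover have "finite C"
    using A(3) finite_vectors_on by (auto simp: C_def finite_mat_columns)
  ultimately show ?thesis
    using gen_set_card_ge[OF F _ C gen] by simp
qed

text \<open>Stated over the reals, so that neither the differences nor the halving are
  truncated.\<close>

lemma sum_path_loads:
  "(\<Sum>m<k. real M - real m * real \<alpha>) = real k * real M - (real k - 1) * real k * real \<alpha> / 2"
proof (induction k)
  case (Suc k)
  then show ?case
    by (simp add: field_simps)
qed simp

lemma sum_count_list_le:
  assumes "finite X"
  shows "sum (count_list xs) X \<le> length xs"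
proof -
  have "sum (count_list xs) X \<le> sum (count_list xs) (X \<union> set xs)"
    using assms by (intro sum_mono2) auto
  then show ?thesis
    using assms sum_count_set[of xs "X \<union> set xs"] by simp
qed

lemma bandwidth_lower_bound:
  assumes "storage_scheme F n \<alpha> M G" and "i < n" and "k \<le> n"
    and "reconstruction_protocol F n \<alpha> M G i ts" and "user_recovers F M i ts"
  shows "real (bandwidth ts) \<ge> real k * real M - (real k - 1) * real k * real \<alpha> / 2"
proof -
  have "(\<Sum>m<k. real M - real m * real \<alpha>) \<le> (\<Sum>m<k. real (count_list (map fst ts) (path_edge n i m)))"
  proof (rule sum_mono)
    fix m assume "m \<in> {..<k}"
    then have "M \<le> m * \<alpha> + count_list (map fst ts) (path_edge n i m)"
      using path_edge_load[OF assms(1,2) _ assms(4,5)] \<open>k \<le> n\<close> by simp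
    then have "real M \<le> real (m * \<alpha> + count_list (map fst ts) (path_edge n i m))"
      by (rule of_nat_mono)
    then show "real M - real m * real \<alpha> \<le> real (count_list (map fst ts) (path_edge n i m))"
      by simp
  qed
  \<comment> \<open>Since \<open>k \<le> n\<close>, the path edges are pairwise distinct, so no
    transmission is counted twice.\<close>
  also have "\<dots> = real (sum (count_list (map fst ts)) (path_edge n i ` {..<k}))"
    using inj_on_subset[OF inj_on_path_edge] \<open>k \<le> n\<close>
    by (subst sum.reindex) auto
  also have "\<dots> \<le> real (bandwidth ts)"
    using sum_count_list_le[of "path_edge n i ` {..<k}" "map fst ts"]
    by (simp add: bandwidth_def del: of_nat_sum)
  finally show ?thesis
    by (simp only: sum_path_loads)
qed

section \<open>A Vandermonde storage scheme\<close>

definition vandermonde_vector :: "nat \<Rightarrow> nat \<Rightarrow> nat \<Rightarrow> int cvec" where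
  "vandermonde_vector p m x = (\<lambda>r\<in>{..<m}. int x ^ r mod int p)"

text \<open>
  A vanishing combination of Vandermonde vectors annihilates every polynomial of degree less
  than \<open>m\<close>. The polynomial with roots at all nodes but \<open>x\<close> isolates the coefficient of \<open>x\<close>.
\<close>

lemma power_sums_cong_0_imp:
  fixes c :: "nat \<Rightarrow> int" and X :: "nat set"
  assumes "prime p" and X: "finite X" "X \<subseteq> {..<p}" and x: "x \<in> X"
    and 0: "\<And>r. r < card X \<Longrightarrow> int p dvd (\<Sum>y\<in>X. c y * int y ^ r)"
  shows "int p dvd c x"
proof -
  define f where "f = (\<Prod>y\<in>X - {x}. [:- int y, 1:])"
  \<comment> \<open>The degree stays below \<open>card X\<close>, so the assumed power sums cover
    every coefficient of \<open>f\<close>.\<close>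
  have "degree f = card X - 1"
    unfolding f_def using X(1) x by (subst degree_prod_eq_sum_degree) auto
  then have deg: "degree f < card X"
    using X(1) x card_gt_0_iff[of X] by auto
  have "(\<Sum>y\<in>X. c y * poly f (int y)) = (\<Sum>y\<in>X. \<Sum>r\<le>degree f. coeff f r * (c y * int y ^ r))"
    by (simp add: poly_altdef sum_distrib_left mult_ac)
  also have "\<dots> = (\<Sum>r\<le>degree f. coeff f r * (\<Sum>y\<in>X. c y * int y ^ r))"
    by (subst sum.swap) (simp add: sum_distrib_left)
  finally have eq: "(\<Sum>y\<in>X. c y * poly f (int y)) =
    (\<Sum>r\<le>degree f. coeff f r * (\<Sum>y\<in>X. c y * int y ^ r))" .
  have "int p dvd (\<Sum>y\<in>X. c y * poly f (int y))"
    unfolding eq by (intro dvd_sum dvd_mult 0) (use deg in auto)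
  moreover have "(\<Sum>y\<in>X. c y * poly f (int y)) = c x * poly f (int x)"
    using X(1) x
    by (subst sum.remove[OF X(1) x]) (auto simp: f_def poly_prod intro!: sum.neutral)
  \<comment> \<open>Otherwise the prime \<open>p\<close> would divide a difference of two distinct
    evaluation points below \<open>p\<close>.\<close>
  moreover have "\<not> int p dvd poly f (int x)"
  proof
    assume "int p dvd poly f (int x)"
    then have "int p dvd (\<Prod>y\<in>X - {x}. int x - int y)"
      by (simp add: f_def poly_prod)
    then obtain y where y: "y \<in> X - {x}" "int p dvd int x - int y"
      using \<open>prime p\<close> X(1) by (auto simp: prime_dvd_prod_iff)
    then have "[x = y] (mod p)"
      by (simp add: cong_iff_dvd_diff flip: cong_int_iff)
    moreover have "x < p" "y < p"
      using X(2) x y by auto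
    ultimately have "x = y"
      by (simp add: cong_def)
    with y show False by simp
  qed
  ultimately show ?thesis
    using \<open>prime p\<close> by (simp add: prime_dvd_mult_iff)
qed

lemma vandermonde_vector_carrier:
  assumes "prime p"
  shows "vandermonde_vector p m x \<in> carrier (coord_space (residue_ring (int p)) m)"
proof -
  interpret residues_prime p "residue_ring (int p)"
    by unfold_locales (use assms in auto)
  show ?thesis
    by (auto simp: vandermonde_vector_def func_space_simps)
qed

text \<open>By \<open>power_sums_cong_0_imp\<close> the vectors are independent, and
  \<open>m\<close> independent vectors in dimension \<open>m\<close> form a basis.\<close>

lemma vandermonde_vectors_gen:
  assumes p: "prime p" and X: "X \<subseteq> {..<p}" "card X = m"
  shows "vec_span (residue_ring (int p)) m (vandermonde_vector p m ` X) =
    carrier (coord_space (residue_ring (int p)) m)"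
proof -
  let ?F = "residue_ring (int p)"
  let ?V = "coord_space ?F m"
  interpret residues_prime p ?F
    by unfold_locales (use p in auto)
  interpret V: vectorspace ?F ?V
    by (rule vectorspace_func_space)
  let ?w = "vandermonde_vector p m"
  have fin: "finite X"
    using X(1) finite_subset by blast
  have sub: "?w ` X \<subseteq> carrier ?V"
    using vandermonde_vector_carrier[OF p] by auto
  have inj: "inj_on ?w X"
  proof (rule inj_onI, rule ccontr)
    fix x y assume xy: "x \<in> X" "y \<in> X" "?w x = ?w y" "x \<noteq> y"
    then have "card {x, y} \<le> card X"
      by (intro card_mono fin) auto
    \<comment> \<open>This makes row 1 available, whose entry is the evaluation point itself modulo
      \<open>p\<close>.\<close>
    then have "m > 1"
      using X(2) xy(4) by simp
    then have "int (x mod p) = int (y mod p)"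
      using fun_cong[OF xy(3), of 1] by (simp add: vandermonde_vector_def of_nat_mod)
    moreover have "x < p" "y < p"
      using xy X(1) by auto
    ultimately show False
      using xy(4) by simp
  qed
  have "V.lin_indpt (?w ` X)"
  proof (rule V.finite_lin_indpt2[OF _ sub], use fin in simp, intro ballI)
    fix a v
    assume a: "a \<in> ?w ` X \<rightarrow> carrier ?F" and 0: "V.lincomb a (?w ` X) = \<zero>\<^bsub>?V\<^esub>" and "v \<in> ?w ` X"
    then obtain x where x: "x \<in> X" "v = ?w x"
      by auto
    have "int p dvd (\<Sum>y\<in>X. a (?w y) * int y ^ r)" if "r < card X" for r
    proof -
      have r: "r < m" using that X(2) by simp
      have ay: "a (?w y) mod int p = a (?w y)" if "y \<in> X" for y
        using a that by (auto simp: res_carrier_eq Pi_iff)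
      have "V.lincomb a (?w ` X) r = (\<Oplus>\<^bsub>?F\<^esub>v\<in>?w ` X. a v \<otimes>\<^bsub>?F\<^esub> v r)"
        using lincomb_func_space_apply[OF _ sub a] fin r by simp
      also have "\<dots> = (\<Oplus>\<^bsub>?F\<^esub>y\<in>X. a (?w y) \<otimes>\<^bsub>?F\<^esub> ?w y r)"
        using a sub r by (intro finsum_reindex inj) (auto simp: func_space_simps)
      also have "\<dots> = (\<Oplus>\<^bsub>?F\<^esub>y\<in>X. (a (?w y) * int y ^ r) mod int p)"
        using r ay
        by (intro finsum_cong') (auto simp: vandermonde_vector_def res_mult_eq mod_mult_right_eq)
      also have "\<dots> = (\<Sum>y\<in>X. a (?w y) * int y ^ r) mod int p"
        by (rule sum_cong[OF fin])
      finally show ?thesis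
        using 0 r by (simp add: func_space_simps res_zero_eq dvd_eq_mod_eq_0)
    qed
    then have "int p dvd a (?w x)"
      using power_sums_cong_0_imp[OF p fin X(1) x(1), of "\<lambda>y. a (?w y)"] by blast
    \<comment> \<open>The carrier consists of reduced representatives, among which only 0 is
      divisible by \<open>p\<close>.\<close>
    moreover have "a (?w x) \<in> {0..int p - 1}"
      using a x by (auto simp: res_carrier_eq)
    ultimately show "a v = \<zero>\<^bsub>?F\<^esub>"
      using x(2) by (auto simp: res_zero_eq dest: zdvd_imp_le)
  qed
  then have "V.basis (?w ` X)"
    using V.dim_li_is_basis[OF dim_func_space(2) _ sub] fin inj X(2) dim_func_space(1)
    by (simp add: card_image)
  then show ?thesis
    by (simp add: V.basis_def)
qed

text \<open>Evaluation points are numbered consecutively through the blocks, so column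
  \<open>c\<close> of the concatenated generator matrix belongs to the point
  \<open>c\<close>.\<close>

definition vandermonde_scheme :: "nat \<Rightarrow> nat \<Rightarrow> nat \<Rightarrow> int cmat" where
  "vandermonde_scheme p \<alpha> j = (\<lambda>r c. int (j * \<alpha> + c) ^ r mod int p)"

lemma mat_column_vandermonde_scheme:
  "mat_column m (vandermonde_scheme p \<alpha> j) c = vandermonde_vector p m (j * \<alpha> + c)"
  by (simp add: mat_column_def vandermonde_scheme_def vandermonde_vector_def)

lemma mat_columns_vandermonde_generator:
  "mat_columns m l (generator_matrix \<alpha> (vandermonde_scheme p \<alpha>)) = vandermonde_vector p m ` {..<l}"
  by (simp add: mat_columns_def mat_column_def generator_matrix_def vandermonde_scheme_def
      vandermonde_vector_def flip: of_nat_mult of_nat_add)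

lemma storage_scheme_vandermonde:
  assumes "prime p" and "n * \<alpha> < p" and "M \<le> n * \<alpha>"
  shows "storage_scheme (residue_ring (int p)) n \<alpha> M (vandermonde_scheme p \<alpha>)"
proof -
  let ?F = "residue_ring (int p)"
  interpret residues_prime p ?F
    by unfold_locales (use assms in auto)
  interpret V: vectorspace ?F "coord_space ?F M"
    by (rule vectorspace_func_space)
  \<comment> \<open>Full row rank is already reached by the first \<open>M\<close> columns.\<close>
  have "V.span (vandermonde_vector p M ` {..<M}) \<subseteq> V.span (vandermonde_vector p M ` {..<n * \<alpha>})"
    using assms(3) by (intro V.span_is_monotone) auto
  moreover have "V.span (vandermonde_vector p M ` {..<M}) = carrier (coord_space ?F M)"
    using assms by (intro vandermonde_vectors_gen) auto
  moreover have "V.span (vandermonde_vector p M ` {..<n * \<alpha>}) \<subseteq> carrier (coord_space ?F M)"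
    using vandermonde_vector_carrier[OF assms(1)] by (intro V.span_is_subset2) auto
  ultimately have "V.span (vandermonde_vector p M ` {..<n * \<alpha>}) = carrier (coord_space ?F M)"
    by auto
  then have "mat_rank ?F M (n * \<alpha>) (generator_matrix \<alpha> (vandermonde_scheme p \<alpha>)) = M"
    by (simp add: mat_rank_def mat_columns_vandermonde_generator dim_func_space)
  then show ?thesis
    using field_axioms by (simp add: storage_scheme_def vandermonde_scheme_def)
qed

section \<open>The relay protocol\<close>

text \<open>The appended vectors are sent uncoded and draw only on storage and on what arrived
  during \<open>ts\<close>, so their mutual order is irrelevant.\<close>

lemma reconstruction_protocol_append:
  assumes F: "field F" and ts: "reconstruction_protocol F n \<alpha> M G i ts"
    and us: "\<And>e v. (e, v) \<in> set us \<Longrightarrow> e \<in> insert (Access i) (Ring ` {..<n}) \<and>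
      v \<in> carrier (coord_space F M) \<and>
      v \<in> mat_columns M \<alpha> (G (sender e)) \<union> received_by_node n ts (sender e)"
  shows "reconstruction_protocol F n \<alpha> M G i (ts @ us)"
  unfolding reconstruction_protocol_def
proof (intro allI impI)
  interpret field F by fact
  fix t assume t: "t < length (ts @ us)"
  show "case (ts @ us) ! t of (e, v) \<Rightarrow> e \<in> insert (Access i) (Ring ` {..<n}) \<and>
    v \<in> vec_span F M (mat_columns M \<alpha> (G (sender e)) \<union>
      received_by_node n (take t (ts @ us)) (sender e))"
  proof (cases "t < length ts")
    case True
    then show ?thesis
      using ts by (simp add: reconstruction_protocol_def nth_append)
  next
    case False
    obtain e v where ev: "us ! (t - length ts) = (e, v)"
      by (cases "us ! (t - length ts)")
    have "(e, v) \<in> set us"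
      using False t ev nth_mem[of "t - length ts" us] by simp
    note us = us[OF this]
    have "received_by_node n ts (sender e) \<subseteq> received_by_node n (take t (ts @ us)) (sender e)"
      using False by (auto simp: received_by_node_def)
    then have "v \<in> vec_span F M (mat_columns M \<alpha> (G (sender e)) \<union>
        received_by_node n (take t (ts @ us)) (sender e))"
      using us by (intro span_memI) auto
    then show ?thesis
      using False us ev by (simp add: nth_append)
  qed
qed

text \<open>
  Position \<open>q\<close> stands for a column stored \<open>q div \<alpha>\<close> steps upstream of the user's node, so the edge
  \<open>m\<close> steps upstream has to carry the positions from \<open>m \<alpha>\<close> on.
\<close>

definition relay_block :: "nat \<Rightarrow> nat \<Rightarrow> nat \<Rightarrow> nat \<Rightarrow> (nat \<Rightarrow> 'f cvec) \<Rightarrow> nat \<Rightarrow> 'f transmission list" where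
  "relay_block n i \<alpha> M col m = map (\<lambda>q. (path_edge n i m, col q)) [m * \<alpha>..<M]"

text \<open>The list is reversed because the farthest edge must transmit first. Stopping at a
  variable edge \<open>m\<close> gives the partial protocols needed for induction; the full one has
  \<open>m = 0\<close>.\<close>

definition relay_protocol :: "nat \<Rightarrow> nat \<Rightarrow> nat \<Rightarrow> nat \<Rightarrow> nat \<Rightarrow> (nat \<Rightarrow> 'f cvec) \<Rightarrow> nat \<Rightarrow> 'f transmission list" where
  "relay_protocol n i \<alpha> M k col m = concat (map (relay_block n i \<alpha> M col) (rev [m..<k]))"

lemma relay_protocol_step:
  "m < k \<Longrightarrow> relay_protocol n i \<alpha> M k col m =
    relay_protocol n i \<alpha> M k col (Suc m) @ relay_block n i \<alpha> M col m"
  by (simp add: relay_protocol_def upt_conv_Cons)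

lemma set_relay_protocol:
  "set (relay_protocol n i \<alpha> M k col m) =
    {(path_edge n i l, col q) | l q. m \<le> l \<and> l < k \<and> l * \<alpha> \<le> q \<and> q < M}"
  by (fastforce simp: relay_protocol_def relay_block_def)

lemma prev_node_add_Suc: "prev_node n ((i + Suc m) mod n) = (i + m) mod n" if "n > 0"
proof -
  have "prev_node n ((i + Suc m) mod n) = ((i + Suc m) mod n + (n - 1)) mod n"
    using that by (simp add: prev_node_def)
  also have "\<dots> = (i + m + n) mod n"
    using that by (simp only: mod_add_left_eq) simp
  finally show ?thesis by simp
qed

lemma sender_path_edge: "i < n \<Longrightarrow> sender (path_edge n i m) = (i + m) mod n"
  by (simp add: path_edge_def)

text \<open>Downward induction from the empty protocol at \<open>m = k\<close>: each position sent
  over edge \<open>m\<close> is either stored at its sender or was delivered by block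
  \<open>m + 1\<close>.\<close>

lemma reconstruction_protocol_relay:
  assumes F: "field F" and "i < n" and "\<alpha> > 0" and M: "M \<le> k * \<alpha>" and "m \<le> k"
    and col: "\<And>q. q < M \<Longrightarrow> col q \<in> carrier (coord_space F M)"
      "\<And>q. q < M \<Longrightarrow> col q \<in> mat_columns M \<alpha> (G ((i + q div \<alpha>) mod n))"
  shows "reconstruction_protocol F n \<alpha> M G i (relay_protocol n i \<alpha> M k col m)"
  using \<open>m \<le> k\<close>
proof (induction m rule: inc_induct)
  case base
  then show ?case
    by (simp add: relay_protocol_def reconstruction_protocol_def)
next
  case (step m)
  let ?ts = "relay_protocol n i \<alpha> M k col (Suc m)"
  have "e \<in> insert (Access i) (Ring ` {..<n}) \<and> v \<in> carrier (coord_space F M) \<and>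
      v \<in> mat_columns M \<alpha> (G (sender e)) \<union> received_by_node n ?ts (sender e)"
    if "(e, v) \<in> set (relay_block n i \<alpha> M col m)" for e v
  proof -
    from that obtain q where q: "m * \<alpha> \<le> q" "q < M" "e = path_edge n i m" "v = col q"
      by (auto simp: relay_block_def)
    have "v \<in> mat_columns M \<alpha> (G (sender e)) \<union> received_by_node n ?ts (sender e)"
    proof (cases "q < Suc m * \<alpha>")
      case True
      then have "q div \<alpha> = m"
        using q(1) \<open>\<alpha> > 0\<close> by (intro div_nat_eqI) (auto simp: mult.commute)
      then show ?thesis
        using col(2)[OF q(2)] q \<open>i < n\<close> by (simp add: sender_path_edge)
    next
      case False
      \<comment> \<open>Here \<open>M \<le> k * \<alpha>\<close> ensures that the position is stored
        at one of the \<open>k\<close> relaying nodes, so block \<open>Suc m\<close> exists and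
        contains it.\<close>
      then have "Suc m * \<alpha> < k * \<alpha>"
        using q(2) M by simp
      then have "Suc m < k"
        by (simp only: mult_less_cancel2)
      then have "(path_edge n i (Suc m), v) \<in> set ?ts"
        using False q by (force simp: set_relay_protocol)
      then have "v \<in> received_by_node n ?ts ((i + m) mod n)"
        using \<open>i < n\<close> prev_node_add_Suc[of n i m]
        by (auto simp: received_by_node_def path_edge_def intro!: exI[of _ "(i + Suc m) mod n"])
      then show ?thesis
        using q \<open>i < n\<close> by (simp add: sender_path_edge)
    qed
    then show ?thesis
      using q col(1) \<open>i < n\<close> by (auto simp: path_edge_def)
  qed
  then show ?case
    using step by (simp add: relay_protocol_step reconstruction_protocol_append[OF F])
qed

text \<open>The hypothesis makes every block length \<open>M - m * \<alpha>\<close> an exact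
  difference, so the cut bounds are met with equality on each edge.\<close>

lemma bandwidth_relay:
  assumes "(k - 1) * \<alpha> \<le> M"
  shows "real (bandwidth (relay_protocol n i \<alpha> M k col 0)) =
    real k * real M - (real k - 1) * real k * real \<alpha> / 2"
proof -
  have "bandwidth (relay_protocol n i \<alpha> M k col 0) = (\<Sum>m<k. M - m * \<alpha>)"
    by (simp add: bandwidth_def relay_protocol_def relay_block_def length_concat
        sum_list_distinct_conv_sum_set atLeast0LessThan)
  also have "real \<dots> = (\<Sum>m<k. real M - real m * real \<alpha>)"
    unfolding of_nat_sum
  proof (rule sum.cong)
    fix m assume "m \<in> {..<k}"
    then have "m * \<alpha> \<le> (k - 1) * \<alpha>"
      by (intro mult_le_mono1) auto
    then have "m * \<alpha> \<le> M"
      using assms by (rule le_trans)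
    then show "real (M - m * \<alpha>) = real M - real m * real \<alpha>"
      by (simp add: of_nat_diff)
  qed simp
  finally show ?thesis
    by (simp only: sum_path_loads)
qed

lemma vandermonde_scheme_relay:
  assumes p: "prime p" "n * \<alpha> < p" and "i < n" and "\<alpha> > 0" and "M > 0" and "M \<le> n * \<alpha>" and "M \<le> k * \<alpha>"
  obtains col where
    "reconstruction_protocol (residue_ring (int p)) n \<alpha> M (vandermonde_scheme p \<alpha>) i
      (relay_protocol n i \<alpha> M k col 0)"
    "user_recovers (residue_ring (int p)) M i (relay_protocol n i \<alpha> M k col 0)"
proof
  let ?F = "residue_ring (int p)"
  interpret residues_prime p ?F
    by unfold_locales (use assms in auto)
  \<comment> \<open>The columns are read cyclically from the first one of node \<open>i\<close>;
    reducing modulo \<open>n * \<alpha>\<close> matches the wrap-around of the ring.\<close>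
  define pos where "pos q = (i * \<alpha> + q) mod (n * \<alpha>)" for q
  define col where "col q = vandermonde_vector p M (pos q)" for q
  have pos: "pos q = (i + q div \<alpha>) mod n * \<alpha> + q mod \<alpha>" for q
    using \<open>\<alpha> > 0\<close> mod_mult2_eq[of "i * \<alpha> + q" \<alpha> n] by (simp add: pos_def mult.commute)
  show "reconstruction_protocol ?F n \<alpha> M (vandermonde_scheme p \<alpha>) i (relay_protocol n i \<alpha> M k col 0)"
  proof (rule reconstruction_protocol_relay)
    fix q
    show "col q \<in> carrier (coord_space ?F M)"
      unfolding col_def by (rule vandermonde_vector_carrier[OF p(1)])
    show "col q \<in> mat_columns M \<alpha> (vandermonde_scheme p \<alpha> ((i + q div \<alpha>) mod n))"
      using \<open>\<alpha> > 0\<close>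
      by (auto simp: mat_columns_def mat_column_vandermonde_scheme col_def pos
          intro!: image_eqI[of _ _ "q mod \<alpha>"])
  qed (use assms is_field in auto)
  \<comment> \<open>As \<open>M \<le> n * \<alpha>\<close>, the cyclic window does not overlap
    itself and the user gets \<open>M\<close> distinct evaluation points.\<close>
  have inj: "inj_on pos {..<M}"
    using inj_on_subset[OF inj_on_add_mod[of "i * \<alpha>" "n * \<alpha>"]] \<open>M \<le> n * \<alpha>\<close>
    by (simp add: pos_def[abs_def])
  have "pos q < n * \<alpha>" for q
    using \<open>\<alpha> > 0\<close> \<open>i < n\<close> by (simp add: pos_def)
  then have pos_less: "pos ` {..<M} \<subseteq> {..<p}"
    using p(2) less_trans by blast
  \<comment> \<open>Without this the protocol would contain no access block.\<close>
  have "k > 0"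
    using \<open>M > 0\<close> \<open>M \<le> k * \<alpha>\<close> by (cases k) auto
  then have "received_by_user (relay_protocol n i \<alpha> M k col 0) i = col ` {..<M}"
    by (fastforce simp: received_by_user_def set_relay_protocol path_edge_def split: if_splits)
  also have "\<dots> = vandermonde_vector p M ` pos ` {..<M}"
    by (auto simp: col_def)
  finally show "user_recovers ?F M i (relay_protocol n i \<alpha> M k col 0)"
    using vandermonde_vectors_gen[OF p(1) pos_less, of M] inj
    by (simp add: user_recovers_def card_image)
qed

section \<open>Rounding in \<open>k\<close>, and the two halves combined\<close>

theorem theorem1:
  fixes n \<alpha> M k :: nat
  assumes "n \<ge> 2" and "\<alpha> \<ge> 1" and "M \<ge> 1" and "M \<le> n * \<alpha>"
    and "k = nat \<lceil>real M / real \<alpha>\<rceil>"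
  shows
    "(\<forall>(F :: 'f ring) G i ts.
        storage_scheme F n \<alpha> M G \<and> i < n \<and>
        reconstruction_protocol F n \<alpha> M G i ts \<and> user_recovers F M i ts
        \<longrightarrow> real (bandwidth ts) \<ge> real k * real M - (real k - 1) * real k * real \<alpha> / 2)
     \<and>
     (\<exists>(F :: int ring) G.
        storage_scheme F n \<alpha> M G \<and>
        (\<forall>i<n. \<exists>ts.
           reconstruction_protocol F n \<alpha> M G i ts \<and> user_recovers F M i ts \<and>
           real (bandwidth ts) = real k * real M - (real k - 1) * real k * real \<alpha> / 2))"
proof -
  have ceil: "real k = real_of_int \<lceil>real M / real \<alpha>\<rceil>"
    using assms(5) by (simp add: of_nat_nat)
  have "real M / real \<alpha> \<le> real k" and "real k < real M / real \<alpha> + 1"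
    unfolding ceil by linarith+
  then have "real M \<le> real k * real \<alpha>" and "(real k - 1) * real \<alpha> < real M"
    using assms(2) by (simp_all add: field_simps)
  then have k: "real M \<le> real (k * \<alpha>)" "real (k * \<alpha>) < real (M + \<alpha>)"
    by (simp_all add: algebra_simps)
  then have Mk: "M \<le> k * \<alpha>" and kM: "k * \<alpha> < M + \<alpha>"
    by (simp_all only: of_nat_le_iff of_nat_less_iff)
  \<comment> \<open>The strict side of the ceiling, with \<open>M \<le> n * \<alpha>\<close>, shows
    that the \<open>k\<close> path edges fit on the ring.\<close>
  have "k * \<alpha> < Suc n * \<alpha>"
    using kM assms(4) by simp
  then have kn: "k \<le> n"
    by (simp only: mult_less_cancel2 less_Suc_eq_le)
  obtain p where p: "prime p" "n * \<alpha> < p"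
    using bigger_prime by blast
  have kM': "(k - 1) * \<alpha> \<le> M"
    using kM by (simp add: diff_mult_distrib)
  show ?thesis
  proof (intro conjI allI impI exI[of _ "residue_ring (int p)"] exI[of _ "vandermonde_scheme p \<alpha>"])
    show "storage_scheme (residue_ring (int p)) n \<alpha> M (vandermonde_scheme p \<alpha>)"
      by (rule storage_scheme_vandermonde[OF p assms(4)])
  next
    fix i assume "i < n"
    then obtain col where
      "reconstruction_protocol (residue_ring (int p)) n \<alpha> M (vandermonde_scheme p \<alpha>) i
        (relay_protocol n i \<alpha> M k col 0)"
      "user_recovers (residue_ring (int p)) M i (relay_protocol n i \<alpha> M k col 0)"
      using vandermonde_scheme_relay[OF p, of i M k] assms Mk by auto
    then show "\<exists>ts. reconstruction_protocol (residue_ring (int p)) n \<alpha> M (vandermonde_scheme p \<alpha>) i ts \<and>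
        user_recovers (residue_ring (int p)) M i ts \<and>
        real (bandwidth ts) = real k * real M - (real k - 1) * real k * real \<alpha> / 2"
      using bandwidth_relay[OF kM'] by blast
  next
    fix F :: "'f ring" and G i ts
    assume "storage_scheme F n \<alpha> M G \<and> i < n \<and>
      reconstruction_protocol F n \<alpha> M G i ts \<and> user_recovers F M i ts"
    then show "real k * real M - (real k - 1) * real k * real \<alpha> / 2 \<le> real (bandwidth ts)"
      using bandwidth_lower_bound kn by blast
  qed
qed

end
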